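(* Let $k\in\mathbb{Z}$, let $n\ge0$ be an integer, let $x\in\mathbb{R}$, and let $a,b,c$ be positive reals with $a\ne b$, $b>a$ and $ab\neq1$. Then $$B_n^{(k)}(x;a,b,c)=\sum_{l=0}^{n}\binom{n}{l}(\ln c)^{n-l}(\ln a+\ln b)^l\,B_l^{(k)}\!\left(\frac{-\ln b}{\ln a+\ln b}\right)x^{n-l},$$ and $$B_n^{(k)}(x;a,b,c)=\sum_{l=0}^{n}\sum_{j=0}^{l}(-1)^{l-j}\binom{n}{l}\binom{l}{j}(\ln c)^{n-l}(\ln b)^{l-j}(\ln a+\ln b)^j\,B_j^{(k)}\,x^{n-l}.$$
   Context: For $k\in\mathbb{Z}$ and $|z|<1$ let $\mathrm{Li}_k(z)=\sum_{m\ge1} z^m/m^k$. The poly-Bernoulli numbers $B_n^{(k)}$ are defined by $\frac{\mathrm{Li}_k(1-e^{-x})}{1-e^{-x}}=\sum_{n\ge0}B_n^{(k)}\frac{x^n}{n!}$, and the poly-Bernoulli polynomials $B_n^{(k)}(t)$ by $\frac{\mathrm{Li}_k(1-e^{-x})}{1-e^{-x}}e^{xt}=\sum_{n\ge0}B_n^{(k)}(t)\frac{x^n}{n!}$. For positive reals $a,b$ with $ab\ne1$ and $c>0$, the generalized poly-Bernoulli polynomials $B_n^{(k)}(x;a,b,c)$ are defined by the power series expansion in $t$ (valid for $|t|<2\pi/|\ln a+\ln b|$) $\frac{\mathrm{Li}_k(1-(ab)^{-t})}{b^t-a^{-t}}c^{xt}=\sum_{n\ge0}B_n^{(k)}(x;a,b,c)\frac{t^n}{n!}$.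 *)

theory Defs
  imports Complex_Main
begin

definition polylog :: "int \<Rightarrow> real \<Rightarrow> real" where
  "polylog k z = (\<Sum>m. z ^ Suc m / real (Suc m) powi k)"

text \<open>
  The numbers \<open>B\<^sub>n\<close> with \<open>f t = (\<Sum>n. B\<^sub>n t\<^sup>n / n!)\<close> near \<open>0\<close>. The point \<open>t = 0\<close> itself is
  left out: the generating functions below are of the form \<open>0/0\<close> there (a removable
  singularity), and HOL would evaluate them to \<open>0\<close>. The coefficients are determined by the
  values on a punctured neighbourhood.
\<close>
definition egf_coeff :: "(real \<Rightarrow> real) \<Rightarrow> nat \<Rightarrow> real" where
  "egf_coeff f = (THE B. \<forall>\<^sub>F t in at 0. (\<lambda>n. B n * (t ^ n / fact n)) sums f t)"

definition poly_bernoulli :: "int \<Rightarrow> nat \<Rightarrow> real" where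
  "poly_bernoulli k = egf_coeff (\<lambda>x. polylog k (1 - exp (- x)) / (1 - exp (- x)))"

definition poly_bernoulli_poly :: "int \<Rightarrow> nat \<Rightarrow> real \<Rightarrow> real" where
  "poly_bernoulli_poly k n t =
     egf_coeff (\<lambda>x. polylog k (1 - exp (- x)) / (1 - exp (- x)) * exp (x * t)) n"

definition gen_poly_bernoulli_poly ::
    "int \<Rightarrow> nat \<Rightarrow> real \<Rightarrow> real \<Rightarrow> real \<Rightarrow> real \<Rightarrow> real" where
  "gen_poly_bernoulli_poly k n x a b c =
     egf_coeff (\<lambda>t. polylog k (1 - (a * b) powr (- t)) / (b powr t - a powr (- t))
                     * c powr (x * t)) n"

end

theory Submission
  imports Defs "HOL-Complex_Analysis.Laurent_Convergence"
begin

text \<open>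
  Put \<open>L = ln a + ln b\<close> and let \<open>G x = Li\<^sub>k (1 - e\<^sup>-\<^sup>x) / (1 - e\<^sup>-\<^sup>x)\<close>. Since
  \<open>b\<^sup>t - a\<^sup>-\<^sup>t = b\<^sup>t (1 - e\<^sup>-\<^sup>L\<^sup>t)\<close>, the generating function of the generalized polynomials is
  \<open>G (L t) e\<^bsup>L t s\<^esup> e\<^bsup>t x ln c\<^esup>\<close> with \<open>s = - ln b / L\<close>. Multiplying an exponential
  generating function by an exponential is a binomial convolution of the coefficients, so both
  formulas follow by comparing coefficients. The only analytic inputs are that \<open>G\<close> has a power
  series at \<open>0\<close> and that such a series is determined by its values on a punctured
  neighbourhood.
\<close>

section \<open>Uniqueness of coefficients\<close>

text \<open>The predicate under the description operator of \<open>egf_coeff\<close>. Working with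
  the relation postpones existence and uniqueness until the coefficients are read off by
  \<open>egf_coeff_eqI\<close>.\<close>

definition has_egf :: "(real \<Rightarrow> real) \<Rightarrow> (nat \<Rightarrow> real) \<Rightarrow> bool" where
  "has_egf f B \<longleftrightarrow> (\<forall>\<^sub>F t in at 0. (\<lambda>n. B n * (t ^ n / fact n)) sums f t)"

text \<open>Letting \<open>t\<close> tend to \<open>0\<close> kills the constant term. Dividing the
  rest by \<open>t\<close>, which is nonzero on the punctured disc, gives a shifted series with the
  same property, so induction applies with \<open>a\<close> generalized.\<close>

lemma powser_eq_0_punctured:
  fixes a :: "nat \<Rightarrow> real"
  assumes "s > 0" "\<And>t. t \<noteq> 0 \<Longrightarrow> norm t < s \<Longrightarrow> (\<lambda>n. a n * t ^ n) sums 0"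
  shows "a n = 0"
  using assms(2)
proof (induction n arbitrary: a)
  case 0
  have "((\<lambda>_. 0) \<longlongrightarrow> a 0) (at (0::real))"
    using powser_limit_0_strong[OF assms(1), of a "\<lambda>_. 0"] 0 by blast
  then show ?case
    by (simp add: tendsto_const_iff)
next
  case (Suc n)
  have "((\<lambda>_. 0) \<longlongrightarrow> a 0) (at (0::real))"
    using powser_limit_0_strong[OF assms(1), of a "\<lambda>_. 0"] Suc.prems by blast
  then have a0: "a 0 = 0"
    by (simp add: tendsto_const_iff)
  show ?case
  proof (rule Suc.IH[of "\<lambda>n. a (Suc n)"])
    fix t :: real assume t: "t \<noteq> 0" "norm t < s"
    have "(\<lambda>n. a (Suc n) * t ^ Suc n) sums 0"
      using Suc.prems[OF t] a0 by (subst sums_Suc_iff) simp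
    then have "(\<lambda>n. a (Suc n) * t ^ Suc n / t) sums (0 / t)"
      by (rule sums_divide)
    then show "(\<lambda>n. a (Suc n) * t ^ n) sums 0"
      using t by (simp add: mult_ac)
  qed
qed

lemma has_egf_unique:
  assumes "has_egf f A" "has_egf f B"
  shows "A = B"
proof
  fix n
  have "\<forall>\<^sub>F t in at 0. (\<lambda>n. (A n - B n) / fact n * t ^ n) sums 0"
    using assms unfolding has_egf_def
  proof eventually_elim
    case (elim t)
    then show ?case
      using sums_diff[OF elim] by (simp add: field_simps)
  qed
  then obtain s where "s > 0"
    and "\<And>t. t \<noteq> 0 \<Longrightarrow> norm t < s \<Longrightarrow> (\<lambda>n. (A n - B n) / fact n * t ^ n) sums 0"
    unfolding eventually_at by (auto simp: dist_norm)
  then have "(A n - B n) / fact n = 0"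
    by (rule powser_eq_0_punctured[of s "\<lambda>n. (A n - B n) / fact n"]) auto
  then show "A n = B n" by simp
qed

lemma egf_coeff_eqI: "has_egf f B \<Longrightarrow> egf_coeff f = B"
  unfolding egf_coeff_def has_egf_def[symmetric]
  by (rule the_equality) (auto intro: has_egf_unique)

section \<open>Operations on exponential generating functions\<close>

lemma has_egf_cong:
  assumes "\<forall>\<^sub>F t in at 0. f t = g t" "has_egf f B"
  shows "has_egf g B"
  using assms unfolding has_egf_def by eventually_elim simp

lemma has_egf_scale:
  assumes "has_egf f B" "s \<noteq> 0"
  shows "has_egf (\<lambda>t. f (s * t)) (\<lambda>n. s ^ n * B n)"
proof -
  \<comment> \<open>As \<open>s \<noteq> 0\<close>, \<open>s * t\<close> never hits the excluded
    point.\<close>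
  have "filterlim (\<lambda>t. s * t) (at 0) (at 0)"
    using assms(2) by (auto simp: filterlim_at eventually_at_filter intro!: tendsto_eq_intros)
  from eventually_compose_filterlim[OF assms(1)[unfolded has_egf_def] this]
  show ?thesis
    unfolding has_egf_def by eventually_elim (simp add: power_mult_distrib mult_ac)
qed

text \<open>A formal expansion also fixes the value at \<open>0\<close>. Patching in
  \<open>B 0\<close>, the value of the series there, removes the singularity.\<close>

lemma has_egf_imp_has_fps_expansion:
  assumes "has_egf f B"
  shows "(\<lambda>t. if t = 0 then B 0 else f t) has_fps_expansion Abs_fps (\<lambda>n. B n / fact n)"
proof (rule has_fps_expansionI)
  show "\<forall>\<^sub>F u in nhds 0. (\<lambda>n. fps_nth (Abs_fps (\<lambda>n. B n / fact n)) n * u ^ n) sums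
          (if u = 0 then B 0 else f u)"
    using assms unfolding has_egf_def eventually_at_filter
  proof eventually_elim
    case (elim u)
    then show ?case
      using powser_sums_zero[of "\<lambda>n. B n / fact n"] by (auto simp: field_simps)
  qed
qed

lemma has_fps_expansion_eventually_sums:
  assumes "f has_fps_expansion F"
  shows "\<forall>\<^sub>F z in nhds 0. (\<lambda>n. fps_nth F n * z ^ n) sums f z"
proof -
  have "\<forall>\<^sub>F z in nhds 0. z \<in> eball 0 (fps_conv_radius F)"
    using assms by (intro eventually_nhds_in_open) (auto simp: has_fps_expansion_def zero_ereal_def)
  moreover have "\<forall>\<^sub>F z in nhds 0. eval_fps F z = f z"
    using assms by (simp add: has_fps_expansion_def)
  ultimately show ?thesis
  proof eventually_elim
    case (elim z)
    then show ?case
      using sums_eval_fps[of z F] by simp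
  qed
qed

lemma has_fps_expansion_imp_has_egf:
  assumes "f has_fps_expansion F"
  shows "has_egf f (\<lambda>n. fact n * fps_nth F n)"
  using has_fps_expansion_eventually_sums[OF assms]
  unfolding has_egf_def eventually_at_filter by eventually_elim simp

text \<open>This is the Cauchy product with \<open>fps_exp s\<close>: the factor
  \<open>fact n\<close> turns 1/(l! (n-l)!) into a binomial coefficient. The patch at
  \<open>0\<close> is undone at the end, since only the punctured neighbourhood counts.\<close>

lemma has_egf_mult_exp:
  assumes "has_egf f B"
  shows "has_egf (\<lambda>t. f t * exp (s * t)) (\<lambda>n. \<Sum>l=0..n. real (n choose l) * B l * s ^ (n - l))"
proof -
  let ?F = "Abs_fps (\<lambda>n. B n / fact n)"
  have "has_egf (\<lambda>t. (if t = 0 then B 0 else f t) * exp (s * t))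
          (\<lambda>n. fact n * fps_nth (?F * fps_exp s) n)"
    by (intro has_fps_expansion_imp_has_egf has_fps_expansion_mult has_fps_expansion_exp
              has_egf_imp_has_fps_expansion assms)
  also have "(\<lambda>n. fact n * fps_nth (?F * fps_exp s) n) =
               (\<lambda>n. \<Sum>l=0..n. real (n choose l) * B l * s ^ (n - l))"
    unfolding fps_mult_nth sum_distrib_left
    by (intro ext sum.cong refl) (simp add: binomial_fact)
  finally show ?thesis
    by (rule has_egf_cong[rotated]) (auto simp: eventually_at_filter)
qed

section \<open>Expansion of the poly-Bernoulli generating function\<close>

text \<open>Ratio test: quotients of consecutive coefficients are k-th powers of (m+2)/(m+1), which
  tend to 1 for either sign of \<open>k\<close>.\<close>

lemma conv_radius_polylog:
  fixes k :: int
  shows "conv_radius (\<lambda>m. of_real (1 / real (Suc m) powi k) :: complex) = 1"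
proof (rule conv_radius_ratio_limit_nonzero[of _ 1])
  have "(\<lambda>n. real (Suc (Suc n)) / real (Suc n)) \<longlonglongrightarrow> 1"
    by (rule filterlim_compose[OF LIMSEQ_Suc_n_over_n filterlim_Suc])
  then have "(\<lambda>n. (real (Suc (Suc n)) / real (Suc n)) powi k) \<longlonglongrightarrow> 1 powi k"
    by (intro tendsto_power_int) auto
  then show "(\<lambda>n. norm (of_real (1 / real (Suc n) powi k) :: complex) /
                norm (of_real (1 / real (Suc (Suc n)) powi k) :: complex)) \<longlonglongrightarrow> 1"
    by (simp add: norm_divide norm_power_int power_int_divide_distrib flip: of_nat_Suc)
qed (auto simp: one_ereal_def)

text \<open>
  Composition of power series is only available over the complex numbers, so the expansion is
  obtained there and its real part is restricted to the real line.
\<close>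
lemma poly_bernoulli_gf_has_egf:
  "\<exists>B. has_egf (\<lambda>x. polylog k (1 - exp (- x)) / (1 - exp (- x))) B"
proof -
  \<comment> \<open>\<open>F\<close> is the series of Li_k(z)/z, so the division is already carried
    out and the generating function is \<open>F\<close> composed with 1 - exp(-z). That inner series
    has constant term 0, as composition requires.\<close>
  define F :: "complex fps" where "F = Abs_fps (\<lambda>m. of_real (1 / real (Suc m) powi k))"
  have radius: "fps_conv_radius F = 1"
    using conv_radius_polylog[of k] by (simp add: F_def fps_conv_radius_def)
  have "eval_fps F has_fps_expansion F"
    by (rule eval_fps_has_fps_expansion) (simp add: radius)
  moreover have "(\<lambda>z::complex. 1 - exp (- z)) has_fps_expansion 1 - fps_exp (- 1)"
    by (intro fps_expansion_intros)
  ultimately have "(eval_fps F \<circ> (\<lambda>z. 1 - exp (- z))) has_fps_expansion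
                     fps_compose F (1 - fps_exp (- 1))"
    by (rule has_fps_expansion_compose) simp
  then obtain C where C: "\<forall>\<^sub>F z in nhds 0. (\<lambda>n. C n * z ^ n) sums eval_fps F (1 - exp (- z))"
    using has_fps_expansion_eventually_sums by fastforce
  have lim_of_real: "filterlim complex_of_real (nhds 0) (at 0)"
    by (auto intro!: tendsto_eq_intros)
  have "((\<lambda>t::real. 1 - exp (- t)) \<longlongrightarrow> 0) (at 0)"
    by (auto intro!: tendsto_eq_intros)
  then have "\<forall>\<^sub>F t in at 0. \<bar>1 - exp (- t :: real)\<bar> < 1"
    by (rule order_tendstoD[OF tendsto_rabs_zero]) simp
  moreover have "\<forall>\<^sub>F t in at 0. (t::real) \<noteq> 0"
    by (simp add: eventually_at_filter)
  moreover note eventually_compose_filterlim[OF C lim_of_real]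
  ultimately have
    "has_egf (\<lambda>x. polylog k (1 - exp (- x)) / (1 - exp (- x))) (\<lambda>n. fact n * Re (C n))"
    unfolding has_egf_def
  proof eventually_elim
    case (elim t)
    define w where "w = 1 - exp (- t)"
    have w: "w \<noteq> 0" "\<bar>w\<bar> < 1"
      using elim by (auto simp: w_def)
    have w_complex: "1 - exp (- complex_of_real t) = of_real w"
      by (simp add: w_def exp_of_real flip: of_real_minus)
    have "(\<lambda>n. fps_nth F n * of_real w ^ n) sums eval_fps F (of_real w)"
      using w by (intro sums_eval_fps) (simp add: radius)
    from sums_Re[OF this]
    have "(\<lambda>n. w ^ n / real (Suc n) powi k) sums Re (eval_fps F (of_real w))"
      by (simp add: F_def field_simps flip: of_real_power of_real_mult of_real_divide
               del: of_nat_Suc)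
    \<comment> \<open>Multiplying by \<open>w\<close> restores the exponent \<open>Suc n\<close>
      used in \<open>polylog\<close>.\<close>
    then have "(\<lambda>n. w * (w ^ n / real (Suc n) powi k)) sums (w * Re (eval_fps F (of_real w)))"
      by (rule sums_mult)
    then have "polylog k w = w * Re (eval_fps F (of_real w))"
      unfolding polylog_def by (simp add: sums_iff)
    then have "Re (eval_fps F (of_real w)) = polylog k w / w"
      using w by simp
    moreover have "(\<lambda>n. Re (C n) * t ^ n) sums Re (eval_fps F (of_real w))"
      using sums_Re[OF elim(3)] by (simp add: w_complex flip: of_real_power)
    ultimately show ?case
      by (simp add: w_def)
  qed
  then show ?thesis by blast
qed

lemma has_egf_poly_bernoulli:
  "has_egf (\<lambda>x. polylog k (1 - exp (- x)) / (1 - exp (- x))) (poly_bernoulli k)"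
  using poly_bernoulli_gf_has_egf egf_coeff_eqI unfolding poly_bernoulli_def by metis

lemma
  shows has_egf_poly_bernoulli_poly:
      "has_egf (\<lambda>x. polylog k (1 - exp (- x)) / (1 - exp (- x)) * exp (s * x))
         (\<lambda>n. poly_bernoulli_poly k n s)"
    and poly_bernoulli_poly_eq_sum:
      "poly_bernoulli_poly k n s =
         (\<Sum>j=0..n. real (n choose j) * poly_bernoulli k j * s ^ (n - j))"
proof -
  have *: "has_egf (\<lambda>x. polylog k (1 - exp (- x)) / (1 - exp (- x)) * exp (s * x))
     (\<lambda>n. \<Sum>j=0..n. real (n choose j) * poly_bernoulli k j * s ^ (n - j))"
    by (rule has_egf_mult_exp[OF has_egf_poly_bernoulli])
  show eq: "poly_bernoulli_poly k n s =
      (\<Sum>j=0..n. real (n choose j) * poly_bernoulli k j * s ^ (n - j))" for n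
    unfolding poly_bernoulli_poly_def using egf_coeff_eqI[OF *] by (simp add: mult.commute)
  show "has_egf (\<lambda>x. polylog k (1 - exp (- x)) / (1 - exp (- x)) * exp (s * x))
         (\<lambda>n. poly_bernoulli_poly k n s)"
    using * by (simp add: eq)
qed

section \<open>The generalized polynomials\<close>

lemma gen_poly_bernoulli_poly_eq_sum:
  assumes "a > 0" "b > 0" "c > 0" "a * b \<noteq> 1"
  shows "gen_poly_bernoulli_poly k n x a b c =
           (\<Sum>l=0..n. real (n choose l) * ((ln a + ln b) ^ l
              * poly_bernoulli_poly k l (- ln b / (ln a + ln b))) * (x * ln c) ^ (n - l))"
proof -
  define L where "L = ln a + ln b"
  define s where "s = - ln b / L"
  have L: "L = ln (a * b)"
    using assms by (simp add: L_def ln_mult)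
  have "L \<noteq> 0"
    unfolding L using assms by simp
  \<comment> \<open>This holds even at \<open>t = 0\<close>, where both denominators vanish and both
    quotients are \<open>0\<close> by convention. Being unconditional, it can rewrite under the
    binder below.\<close>
  have gf: "polylog k (1 - exp (- (L * t))) / (1 - exp (- (L * t))) * exp (s * (L * t))
              * exp ((x * ln c) * t) =
            polylog k (1 - (a * b) powr (- t)) / (b powr t - a powr (- t)) * c powr (x * t)" for t
  proof -
    have "(a * b) powr (- t) = exp (- (L * t))"
      using assms by (simp add: powr_def L mult.commute)
    moreover have "b powr t - a powr (- t) = exp (ln b * t) * (1 - exp (- (L * t)))"
      using assms by (simp add: powr_def L_def algebra_simps flip: exp_add)
    \<comment> \<open>\<open>s\<close> is chosen so that \<open>s * L = - ln b\<close>; this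
      exponential supplies the inverse of the b^t factored out of the denominator.\<close>
    moreover have "exp (s * (L * t)) = inverse (exp (ln b * t))"
      using \<open>L \<noteq> 0\<close> by (simp add: s_def flip: exp_minus)
    moreover have "c powr (x * t) = exp ((x * ln c) * t)"
      using assms by (simp add: powr_def mult_ac)
    ultimately show ?thesis
      by (simp add: divide_simps)
  qed
  have "has_egf (\<lambda>t. polylog k (1 - exp (- (L * t))) / (1 - exp (- (L * t))) * exp (s * (L * t))
          * exp ((x * ln c) * t))
        (\<lambda>n. \<Sum>l=0..n. real (n choose l) * (L ^ l * poly_bernoulli_poly k l s)
               * (x * ln c) ^ (n - l))"
    by (intro has_egf_mult_exp has_egf_scale[OF has_egf_poly_bernoulli_poly \<open>L \<noteq> 0\<close>])
  from egf_coeff_eqI[OF this[unfolded gf]] show ?thesis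
    unfolding gen_poly_bernoulli_poly_def by (simp add: L_def s_def)
qed

theorem theorem3:
  fixes k :: int and n :: nat and x a b c :: real
  assumes "a > 0" and "b > 0" and "c > 0"
    and "a \<noteq> b" and "b > a" and "a * b \<noteq> 1"
  shows "gen_poly_bernoulli_poly k n x a b c =
           (\<Sum>l=0..n. real (n choose l) * ln c ^ (n - l) * (ln a + ln b) ^ l
              * poly_bernoulli_poly k l (- ln b / (ln a + ln b)) * x ^ (n - l))
       \<and> gen_poly_bernoulli_poly k n x a b c =
           (\<Sum>l=0..n. \<Sum>j=0..l. (- 1) ^ (l - j) * real (n choose l) * real (l choose j)
              * ln c ^ (n - l) * ln b ^ (l - j) * (ln a + ln b) ^ j
              * poly_bernoulli k j * x ^ (n - l))"
proof -
  define L where "L = ln a + ln b"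
  have "L \<noteq> 0"
    using assms ln_mult[of a b] by (auto simp: L_def)
  have first: "gen_poly_bernoulli_poly k n x a b c =
      (\<Sum>l=0..n. real (n choose l) * ln c ^ (n - l) * L ^ l
         * poly_bernoulli_poly k l (- ln b / L) * x ^ (n - l))"
    using assms by (simp add: gen_poly_bernoulli_poly_eq_sum L_def power_mult_distrib mult_ac)
  \<comment> \<open>Of the \<open>l\<close> factors \<open>L\<close>, \<open>l - j\<close> cancel
    the denominators and \<open>j\<close> remain; \<open>j \<le> l\<close> makes the natural
    subtraction exact.\<close>
  have "L ^ l * (- ln b / L) ^ (l - j) = (- 1) ^ (l - j) * ln b ^ (l - j) * L ^ j"
    if "j \<le> l" for j l
  proof -
    have "L ^ l = L ^ (l - j) * L ^ j"
      using that by (simp flip: power_add)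
    moreover have "L ^ (l - j) * (- ln b / L) ^ (l - j) = (- 1 * ln b) ^ (l - j)"
      using \<open>L \<noteq> 0\<close> by (simp flip: power_mult_distrib)
    ultimately show ?thesis
      by (simp only: power_mult_distrib mult_ac)
  qed
  note cancel = this
  have "gen_poly_bernoulli_poly k n x a b c =
      (\<Sum>l=0..n. \<Sum>j=0..l. real (n choose l) * real (l choose j) * ln c ^ (n - l)
         * (L ^ l * (- ln b / L) ^ (l - j)) * poly_bernoulli k j * x ^ (n - l))"
    unfolding first poly_bernoulli_poly_eq_sum
    by (simp only: sum_distrib_left sum_distrib_right mult_ac)
  also have "\<dots> = (\<Sum>l=0..n. \<Sum>j=0..l. (- 1) ^ (l - j) * real (n choose l) * real (l choose j)
              * ln c ^ (n - l) * ln b ^ (l - j) * L ^ j * poly_bernoulli k j * x ^ (n - l))"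
    by (intro sum.cong refl) (simp only: atLeastAtMost_iff cancel mult_ac)
  finally show ?thesis
    using first unfolding L_def by blast
qed

end
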